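(* Let $\mathbb F=\mathbb R$ or $\mathbb C$, let $c$ be a cardinality, let $M$ be a differentiable manifold, let $k\ge2$, and let $f:M\to\mathbb F^c$ be an embedding. Let $\mathrm{Ind}(f):\mathrm{Ind}(M)\to\mathrm{Ind}(\mathbb F^c)$ be the induced simplicial embedding $\{x_1,\dots,x_l\}\mapsto\{f(x_1),\dots,f(x_l)\}$. Then: (1) $f$ is (real or complex) affinely $k$-regular if and only if $\mathrm{Ind}(f)$ induces a simplicial embedding of $\mathrm{sk}^{k-1}(\mathrm{Ind}(M))$ into $\mathrm{sk}^{k-1}(A_\bullet(\mathbb F^c)/\Sigma_\bullet)$; (2) $f$ is (real or complex) $k$-regular if and only if $\mathrm{Ind}(f)$ induces a simplicial embedding of $\mathrm{sk}^{k-1}(\mathrm{Ind}(M))$ into $\mathrm{sk}^{k-1}(\tilde V_\bullet(\mathbb F^c)/\Sigma_\bullet)$.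
   Context: $\mathbb F^c$ is the $c$-fold direct sum of $\mathbb F$. An embedding $f:M\to\mathbb F^c$ is affinely $k$-regular (resp. $k$-regular) if for any $k$ distinct points $x_1,\dots,x_k\in M$ the vectors $f(x_1),\dots,f(x_k)$ are affinely (resp. linearly) independent over $\mathbb F$. $\mathrm{Ind}(X)$ is the simplicial complex with vertex set $X$ whose simplices are all finite subsets of $X$. $A_\bullet(\mathbb F^c)/\Sigma_\bullet$ is the simplicial complex on vertex set $\mathbb F^c$ whose simplices are the finite affinely independent subsets of $\mathbb F^c$ (orbits of affine frames under permutation); $\tilde V_\bullet(\mathbb F^c)/\Sigma_\bullet$ is the simplicial complex whose simplices are the finite linearly independent subsets of $\mathbb F^c$. $\mathrm{sk}^{k-1}$ denotes the $(k-1)$-skeleton: simplices with at most $k$ vertices. Real or complex (affine) regularity refers to $\mathbb F=\mathbb R$ or $\mathbb F=\mathbb C$.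
   Formalization: M is assumed to have positive dimension or at least k points; otherwise k-regularity is vacuous and the equivalences can fail, e.g. M a single point, f(M)={0}, k=2 for (2), or M three points with collinear images, k=4 for (1). *)

theory Defs
  imports "HOL-Analysis.Analysis" "HOL-Library.Poly_Mapping"
begin

section \<open>The direct sum of copies of a field\<close>

definition ds_scale :: "'f::field \<Rightarrow> ('i \<Rightarrow>\<^sub>0 'f) \<Rightarrow> ('i \<Rightarrow>\<^sub>0 'f)" where
  "ds_scale a v = Poly_Mapping.map ((*) a) v"

lemma lookup_ds_scale [simp]: "poly_mapping.lookup (ds_scale a v) i = a * poly_mapping.lookup v i"
  by (simp add: ds_scale_def map.rep_eq when_def)

interpretation ds: vector_space ds_scale
  by unfold_locales (simp_all add: poly_mapping_eq_iff fun_eq_iff lookup_add distrib_left distrib_right)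

text \<open>The summands are indexed by a set \<open>I\<close> of arbitrary cardinality (the empty set included).\<close>

definition direct_sum :: "'i set \<Rightarrow> ('i \<Rightarrow>\<^sub>0 'f::field) set" where
  "direct_sum I = {v. Poly_Mapping.keys v \<subseteq> I}"

text \<open>
  For finite \<open>J\<close> the subspace \<open>direct_sum J\<close> carries its Euclidean topology, that is, the topology of
  coordinatewise convergence. For arbitrary \<open>I\<close> the direct sum carries the colimit topology over the
  finite \<open>J \<subseteq> I\<close>; this is the Euclidean topology if \<open>I\<close> is finite.
\<close>

definition finite_sum_topology :: "'i set \<Rightarrow> ('i \<Rightarrow>\<^sub>0 'f::real_normed_field) topology" where
  "finite_sum_topology J =
     pullback_topology (direct_sum J) poly_mapping.lookup (product_topology (\<lambda>_. euclidean) UNIV)"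

definition direct_sum_topology :: "'i set \<Rightarrow> ('i \<Rightarrow>\<^sub>0 'f::real_normed_field) topology" where
  "direct_sum_topology I = topology (\<lambda>U. U \<subseteq> direct_sum I \<and>
     (\<forall>J. finite J \<and> J \<subseteq> I \<longrightarrow> openin (finite_sum_topology J) (U \<inter> direct_sum J)))"

lemma topspace_finite_sum_topology: "topspace (finite_sum_topology J) = direct_sum J"
  by (simp add: finite_sum_topology_def topspace_pullback_topology)

lemma openin_direct_sum_topology:
  fixes U :: "('i \<Rightarrow>\<^sub>0 'f::real_normed_field) set"
  shows "openin (direct_sum_topology I) U \<longleftrightarrow> U \<subseteq> direct_sum I \<and>
     (\<forall>J. finite J \<and> J \<subseteq> I \<longrightarrow> openin (finite_sum_topology J) (U \<inter> direct_sum J))"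
proof -
  let ?P = "\<lambda>U :: ('i \<Rightarrow>\<^sub>0 'f) set. U \<subseteq> direct_sum I \<and>
     (\<forall>J. finite J \<and> J \<subseteq> I \<longrightarrow> openin (finite_sum_topology J) (U \<inter> direct_sum J))"
  have "istopology ?P"
    unfolding istopology_def
  proof (intro conjI allI impI)
    fix S T assume S: "?P S" and T: "?P T"
    show "S \<inter> T \<subseteq> direct_sum I" using S by blast
    fix J assume J: "finite J \<and> J \<subseteq> I"
    have "(S \<inter> T) \<inter> direct_sum J = (S \<inter> direct_sum J) \<inter> (T \<inter> direct_sum J)" by blast
    then show "openin (finite_sum_topology J) (S \<inter> T \<inter> direct_sum J)"
      using S T J by (metis openin_Int)
  next
    fix \<K> assume K: "\<forall>U\<in>\<K>. ?P U"
    show "\<Union>\<K> \<subseteq> direct_sum I" using K by blast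
    fix J assume J: "finite J \<and> J \<subseteq> I"
    have "openin (finite_sum_topology J) (\<Union>U\<in>\<K>. U \<inter> direct_sum J)"
      using K J by (intro openin_Union) blast
    then show "openin (finite_sum_topology J) (\<Union>\<K> \<inter> direct_sum J)"
      by (simp only: Int_Union2)
  qed
  from topology_inverse'[OF this] show ?thesis
    by (simp only: direct_sum_topology_def)
qed

lemma topspace_direct_sum_topology [simp]: "topspace (direct_sum_topology I) = direct_sum I"
proof
  show "topspace (direct_sum_topology I) \<subseteq> direct_sum I"
    using openin_topspace by (rule openin_direct_sum_topology [THEN iffD1, THEN conjunct1])
  have "openin (direct_sum_topology I) (direct_sum I)"
  proof (unfold openin_direct_sum_topology, intro conjI allI impI)
    fix J assume "finite J \<and> J \<subseteq> I"
    then have "direct_sum I \<inter> direct_sum J = topspace (finite_sum_topology J)"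
      by (auto simp: topspace_finite_sum_topology direct_sum_def)
    then show "openin (finite_sum_topology J) (direct_sum I \<inter> direct_sum J)"
      by (metis openin_topspace)
  qed simp
  then show "direct_sum I \<subseteq> topspace (direct_sum_topology I)"
    by (rule openin_subset)
qed


section \<open>Differentiable manifolds\<close>

text \<open>
  \<open>C_diff n r W h\<close>: all iterated partial derivatives of order at most \<open>r\<close> of the real-valued function
  \<open>h\<close> exist and are continuous on the open subset \<open>W\<close> of \<open>n\<close>-dimensional Euclidean space.
\<close>

primrec C_diff :: "nat \<Rightarrow> nat \<Rightarrow> (nat \<Rightarrow> real) set \<Rightarrow> ((nat \<Rightarrow> real) \<Rightarrow> real) \<Rightarrow> bool" where
  "C_diff n 0 W h \<longleftrightarrow> continuous_map (subtopology (Euclidean_space n) W) euclideanreal h"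
| "C_diff n (Suc r) W h \<longleftrightarrow>
     continuous_map (subtopology (Euclidean_space n) W) euclideanreal h \<and>
     (\<forall>i<n. \<exists>D. (\<forall>x\<in>W. ((\<lambda>t. h (x(i := t))) has_real_derivative D x) (at (x i))) \<and> C_diff n r W D)"

definition smooth_map :: "nat \<Rightarrow> (nat \<Rightarrow> real) set \<Rightarrow> ((nat \<Rightarrow> real) \<Rightarrow> nat \<Rightarrow> real) \<Rightarrow> bool" where
  "smooth_map n W g \<longleftrightarrow> (\<forall>j<n. \<forall>r. C_diff n r W (\<lambda>x. g x j))"

definition chart :: "nat \<Rightarrow> 'a topology \<Rightarrow> 'a set \<Rightarrow> ('a \<Rightarrow> nat \<Rightarrow> real) \<Rightarrow> bool" where
  "chart n M U \<phi> \<longleftrightarrow> openin M U \<and> openin (Euclidean_space n) (\<phi> ` U) \<and>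
     homeomorphic_map (subtopology M U) (subtopology (Euclidean_space n) (\<phi> ` U)) \<phi>"

definition smooth_atlas :: "nat \<Rightarrow> 'a topology \<Rightarrow> ('a set \<times> ('a \<Rightarrow> nat \<Rightarrow> real)) set \<Rightarrow> bool" where
  "smooth_atlas n M \<A> \<longleftrightarrow>
     (\<forall>(U, \<phi>)\<in>\<A>. chart n M U \<phi>) \<and> (\<Union>(U, \<phi>)\<in>\<A>. U) = topspace M \<and>
     (\<forall>(U, \<phi>)\<in>\<A>. \<forall>(V, \<psi>)\<in>\<A>. smooth_map n (\<phi> ` (U \<inter> V)) (\<psi> \<circ> inv_into U \<phi>))"

definition differentiable_manifold ::
    "nat \<Rightarrow> 'a topology \<Rightarrow> ('a set \<times> ('a \<Rightarrow> nat \<Rightarrow> real)) set \<Rightarrow> bool" where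
  "differentiable_manifold n M \<A> \<longleftrightarrow>
     Hausdorff_space M \<and> second_countable M \<and> smooth_atlas n M \<A>"


section \<open>Independent families and regular maps\<close>

definition lin_independent_family :: "'j set \<Rightarrow> ('j \<Rightarrow> ('i \<Rightarrow>\<^sub>0 'f::field)) \<Rightarrow> bool" where
  "lin_independent_family J v \<longleftrightarrow>
     (\<forall>a. (\<Sum>j\<in>J. ds_scale (a j) (v j)) = 0 \<longrightarrow> (\<forall>j\<in>J. a j = 0))"

definition aff_independent_family :: "'j set \<Rightarrow> ('j \<Rightarrow> ('i \<Rightarrow>\<^sub>0 'f::field)) \<Rightarrow> bool" where
  "aff_independent_family J v \<longleftrightarrow>
     (\<forall>a. (\<Sum>j\<in>J. ds_scale (a j) (v j)) = 0 \<and> (\<Sum>j\<in>J. a j) = 0 \<longrightarrow> (\<forall>j\<in>J. a j = 0))"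

definition k_regular :: "nat \<Rightarrow> 'a set \<Rightarrow> ('a \<Rightarrow> ('i \<Rightarrow>\<^sub>0 'f::field)) \<Rightarrow> bool" where
  "k_regular k X f \<longleftrightarrow>
     (\<forall>x :: nat \<Rightarrow> 'a. inj_on x {1..k} \<and> x ` {1..k} \<subseteq> X \<longrightarrow>
        lin_independent_family {1..k} (\<lambda>i. f (x i)))"

definition affinely_k_regular :: "nat \<Rightarrow> 'a set \<Rightarrow> ('a \<Rightarrow> ('i \<Rightarrow>\<^sub>0 'f::field)) \<Rightarrow> bool" where
  "affinely_k_regular k X f \<longleftrightarrow>
     (\<forall>x :: nat \<Rightarrow> 'a. inj_on x {1..k} \<and> x ` {1..k} \<subseteq> X \<longrightarrow>
        aff_independent_family {1..k} (\<lambda>i. f (x i)))"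


section \<open>Simplicial complexes\<close>

text \<open>
  Abstract simplicial complexes are represented by their sets of simplices. The empty simplex is
  allowed; the vertices are the elements of the simplices.
\<close>

definition abstract_simplicial_complex :: "'a set set \<Rightarrow> bool" where
  "abstract_simplicial_complex K \<longleftrightarrow> (\<forall>\<sigma>\<in>K. finite \<sigma> \<and> (\<forall>\<tau>. \<tau> \<subseteq> \<sigma> \<longrightarrow> \<tau> \<in> K))"

definition skeleton :: "nat \<Rightarrow> 'a set set \<Rightarrow> 'a set set" where
  "skeleton d K = {\<sigma> \<in> K. card \<sigma> \<le> d + 1}"

definition simplicial_embedding ::
    "'a set set \<Rightarrow> 'b set set \<Rightarrow> ('a set \<Rightarrow> 'b set) \<Rightarrow> bool" where
  "simplicial_embedding K L F \<longleftrightarrow>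
     (\<exists>\<phi>. inj_on \<phi> (\<Union>K) \<and> (\<forall>\<sigma>\<in>K. F \<sigma> = \<phi> ` \<sigma> \<and> F \<sigma> \<in> L))"

definition Ind :: "'a set \<Rightarrow> 'a set set" where
  "Ind X = {\<sigma>. finite \<sigma> \<and> \<sigma> \<subseteq> X}"

definition Ind_map :: "('a \<Rightarrow> 'b) \<Rightarrow> 'a set \<Rightarrow> 'b set" where
  "Ind_map f \<sigma> = f ` \<sigma>"

definition affine_frame_complex :: "'i set \<Rightarrow> ('i \<Rightarrow>\<^sub>0 'f::field) set set" where
  "affine_frame_complex I =
     {\<sigma>. finite \<sigma> \<and> \<sigma> \<subseteq> direct_sum I \<and> aff_independent_family \<sigma> (\<lambda>v. v)}"

definition linear_frame_complex :: "'i set \<Rightarrow> ('i \<Rightarrow>\<^sub>0 'f::field) set set" where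
  "linear_frame_complex I = {\<sigma>. finite \<sigma> \<and> \<sigma> \<subseteq> direct_sum I \<and> ds.independent \<sigma>}"

lemma lin_independent_family_self:
  assumes "finite S"
  shows "lin_independent_family S (\<lambda>v. v) \<longleftrightarrow> ds.independent S"
  unfolding lin_independent_family_def ds.dependent_finite[OF assms] by blast

lemma simplicial_embedding_Ind_map:
  assumes "inj_on f X" "f ` X \<subseteq> Y"
  shows "simplicial_embedding (Ind X) (Ind Y) (Ind_map f)"
proof -
  have "inj_on f (\<Union>(Ind X))"
    using assms(1) by (rule inj_on_subset) (auto simp: Ind_def)
  then show ?thesis
    using assms(2) unfolding simplicial_embedding_def
    by (intro exI[of _ f]) (auto simp: Ind_def Ind_map_def)
qed

lemma abstract_simplicial_complex_Ind: "abstract_simplicial_complex (Ind X)"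
  unfolding abstract_simplicial_complex_def Ind_def by (blast intro: finite_subset)

lemma abstract_simplicial_complex_skeleton:
  assumes "abstract_simplicial_complex K"
  shows "abstract_simplicial_complex (skeleton d K)"
  unfolding abstract_simplicial_complex_def skeleton_def
proof (intro ballI conjI allI impI)
  fix \<sigma> \<tau>
  assume "\<sigma> \<in> {\<sigma> \<in> K. card \<sigma> \<le> d + 1}"
  then have K: "\<sigma> \<in> K" "card \<sigma> \<le> d + 1" by auto
  then show fin: "finite \<sigma>" using assms by (simp add: abstract_simplicial_complex_def)
  assume "\<tau> \<subseteq> \<sigma>"
  then show "\<tau> \<in> {\<sigma> \<in> K. card \<sigma> \<le> d + 1}"
    using assms K card_mono[OF fin, of \<tau>] by (simp add: abstract_simplicial_complex_def)
qed

lemma abstract_simplicial_complex_linear_frame_complex: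
  "abstract_simplicial_complex (linear_frame_complex I)"
  unfolding abstract_simplicial_complex_def linear_frame_complex_def
  using ds.independent_mono finite_subset by (smt (verit) mem_Collect_eq order_trans)

lemma aff_independent_family_mono:
  assumes "aff_independent_family S v" "finite S" "T \<subseteq> S"
  shows "aff_independent_family T v"
  unfolding aff_independent_family_def
proof (intro allI impI ballI)
  fix a j
  assume a: "(\<Sum>j\<in>T. ds_scale (a j) (v j)) = 0 \<and> sum a T = 0" and j: "j \<in> T"
  define b where "b = (\<lambda>j. if j \<in> T then a j else 0)"
  have "(\<Sum>j\<in>S. ds_scale (b j) (v j)) = (\<Sum>j\<in>T. ds_scale (a j) (v j))"
    by (rule sum.mono_neutral_cong_right) (use assms in \<open>auto simp: b_def\<close>)
  moreover have "sum b S = sum a T"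
    by (rule sum.mono_neutral_cong_right) (use assms in \<open>auto simp: b_def\<close>)
  ultimately have "(\<Sum>j\<in>S. ds_scale (b j) (v j)) = 0 \<and> sum b S = 0"
    using a by (simp only:)
  then have "\<forall>j\<in>S. b j = 0"
    using assms(1) unfolding aff_independent_family_def by blast
  then have "b j = 0" using j assms(3) by blast
  then show "a j = 0" using j by (simp add: b_def)
qed

lemma abstract_simplicial_complex_affine_frame_complex:
  "abstract_simplicial_complex (affine_frame_complex I)"
  unfolding abstract_simplicial_complex_def affine_frame_complex_def
  by (blast intro: finite_subset aff_independent_family_mono)

end

theory Submission
  imports Defs
begin

text \<open>
  Independence passes to subfamilies, so a simplicial embedding of the \<open>(k - 1)\<close>-skeleton is decided
  on the simplices with exactly \<open>k\<close> vertices, provided that every smaller simplex of \<open>Ind M\<close> is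
  contained in such a one. The latter holds because a nonempty manifold of positive dimension has
  infinitely many points; in dimension zero one has to assume that \<open>M\<close> has at least \<open>k\<close> points.
\<close>

section \<open>Manifolds of positive dimension are empty or infinite\<close>

text \<open>A line through a point of \<open>V\<close> in the direction of the first coordinate
  meets \<open>V\<close> in a nonempty open subset of the real line, and such a subset is
  infinite.\<close>

lemma infinite_open_Euclidean_space:
  assumes "openin (Euclidean_space n) V" "V \<noteq> {}" "n \<ge> 1"
  shows "infinite V"
proof -
  obtain x where x: "x \<in> V" using assms by blast
  then have "x \<in> topspace (Euclidean_space n)"
    using assms(1) openin_subset by blast
  then have x0: "\<And>i. i \<ge> n \<Longrightarrow> x i = 0"
    by (simp add: topspace_Euclidean_space)
  \<comment> \<open>Since \<open>n \<ge> 1\<close>, coordinate 0 is one of the free coordinates, so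
    this line stays in \<open>Euclidean_space n\<close>.\<close>
  define g where "g = (\<lambda>t :: real. x(0 := t))"
  have "continuous_map euclideanreal (powertop_real UNIV) g"
    by (simp add: continuous_map_componentwise_UNIV g_def)
  then have "continuous_map euclideanreal (Euclidean_space n) g"
    using x0 assms(3) by (auto simp: Euclidean_space_def continuous_map_in_subtopology g_def)
  then have "open (g -` V)"
    using openin_continuous_map_preimage[OF _ assms(1)] by (fastforce simp: vimage_def)
  moreover have "x 0 \<in> g -` V"
    using x by (simp add: g_def)
  ultimately have "infinite (g -` V)"
    using finite_imp_not_open by blast
  moreover have "inj g"
    by (metis g_def fun_upd_same injI)
  ultimately show ?thesis
    using finite_vimageI by blast
qed

text \<open>The image of a nonempty chart domain is open in Euclidean space, hence infinite, and so
  the domain itself is infinite.\<close>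

lemma infinite_manifold:
  assumes "differentiable_manifold n M \<A>" "topspace M \<noteq> {}" "n \<ge> 1"
  shows "infinite (topspace M)"
proof -
  have atlas: "smooth_atlas n M \<A>"
    using assms(1) by (simp add: differentiable_manifold_def)
  moreover obtain p where "p \<in> topspace M"
    using assms(2) by blast
  ultimately have "p \<in> (\<Union>(U, \<phi>)\<in>\<A>. U)"
    unfolding smooth_atlas_def by simp
  then obtain U \<phi> where U: "(U, \<phi>) \<in> \<A>" "U \<noteq> {}"
    by blast
  then have "chart n M U \<phi>"
    using atlas unfolding smooth_atlas_def by blast
  then have "openin M U" "openin (Euclidean_space n) (\<phi> ` U)"
    by (simp_all add: chart_def)
  then have "U \<subseteq> topspace M" "infinite (\<phi> ` U)"
    using openin_subset infinite_open_Euclidean_space U(2) assms(3) by blast+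
  then show ?thesis
    by (meson finite_imageI finite_subset)
qed

section \<open>Embeddings of skeleta, tested on simplices with \<open>k\<close> vertices\<close>

text \<open>Enough points remain outside \<sigma> to fill it up. Infinite \<open>X\<close> is a
  separate alternative in the hypothesis because \<open>card\<close> is 0 on infinite sets.\<close>

lemma subset_extends_to_card:
  assumes "\<sigma> \<subseteq> X" "finite \<sigma>" "card \<sigma> \<le> k" "infinite X \<or> k \<le> card X"
  obtains \<tau> where "\<sigma> \<subseteq> \<tau>" "\<tau> \<subseteq> X" "finite \<tau>" "card \<tau> = k"
proof -
  obtain T where T: "T \<subseteq> X - \<sigma>" "finite T" "card T = k - card \<sigma>"
  proof (cases "finite X")
    case True
    then have "k - card \<sigma> \<le> card (X - \<sigma>)"
      using assms by (simp add: card_Diff_subset)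
    then show ?thesis
      using that by (metis obtain_subset_with_card_n)
  next
    case False
    then have "infinite (X - \<sigma>)"
      using assms(2) by simp
    then show ?thesis
      using that infinite_arbitrarily_large by metis
  qed
  \<comment> \<open>The truncated difference \<open>k - card \<sigma>\<close> is exact because
    \<open>card \<sigma> \<le> k\<close>.\<close>
  moreover from T have "card (\<sigma> \<union> T) = k"
    using assms by (subst card_Un_disjoint) auto
  ultimately show ?thesis
    using assms that[of "\<sigma> \<union> T"] by blast
qed

text \<open>One direction restricts to the top simplices of the skeleton; the other enlarges a
  simplex to \<open>k\<close> vertices and uses that \<open>L\<close> is closed under subsets. If
  \<open>X\<close> had between 1 and \<open>k - 1\<close> points, the right-hand side would hold
  vacuously while the left-hand side could fail.\<close>

lemma simplicial_embedding_skeleton_iff: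
  assumes "inj_on f X" "k > 0" "X = {} \<or> infinite X \<or> k \<le> card X"
    and L: "abstract_simplicial_complex L" "{} \<in> L"
  shows "simplicial_embedding (skeleton (k - 1) (Ind X)) (skeleton (k - 1) L) (Ind_map f) \<longleftrightarrow>
    (\<forall>\<sigma>\<subseteq>X. card \<sigma> = k \<longrightarrow> f ` \<sigma> \<in> L)" (is "?E \<longleftrightarrow> ?R")
proof
  assume E: ?E
  show ?R
  proof (intro allI impI)
    fix \<sigma> assume "\<sigma> \<subseteq> X" "card \<sigma> = k"
    \<comment> \<open>As \<open>k > 0\<close>, the bound \<open>(k - 1) + 1\<close> in
      \<open>skeleton\<close> equals \<open>k\<close>, and \<open>card \<sigma> = k\<close> forces
      \<sigma> to be finite.\<close>
    then have "\<sigma> \<in> skeleton (k - 1) (Ind X)"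
      using assms(2) by (auto simp: skeleton_def Ind_def intro: card_ge_0_finite)
    then show "f ` \<sigma> \<in> L"
      using E by (auto simp: simplicial_embedding_def Ind_map_def skeleton_def)
  qed
next
  assume R: ?R
  have "f ` \<sigma> \<in> skeleton (k - 1) L" if "\<sigma> \<in> skeleton (k - 1) (Ind X)" for \<sigma>
  proof -
    have \<sigma>: "\<sigma> \<subseteq> X" "finite \<sigma>" "card \<sigma> \<le> k"
      using that assms(2) by (auto simp: skeleton_def Ind_def)
    \<comment> \<open>For empty \<open>X\<close> there is no larger simplex, but then \<sigma> is
      empty and \<open>{} \<in> L\<close> applies.\<close>
    have "f ` \<sigma> \<in> L"
    proof (cases "X = {}")
      case True
      then show ?thesis using \<sigma> L(2) by simp
    next
      case False
      then obtain \<tau> where "\<sigma> \<subseteq> \<tau>" "\<tau> \<subseteq> X" "card \<tau> = k"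
        using assms(3) \<sigma> subset_extends_to_card by metis
      then have "f ` \<tau> \<in> L" "f ` \<sigma> \<subseteq> f ` \<tau>"
        using R by auto
      then show ?thesis
        using L(1) by (auto simp: abstract_simplicial_complex_def)
    qed
    moreover have "card (f ` \<sigma>) \<le> k"
      using card_image_le[OF \<sigma>(2), of f] \<sigma>(3) by simp
    ultimately show ?thesis
      using assms(2) by (simp add: skeleton_def)
  qed
  \<comment> \<open>The map \<open>f\<close> itself is the witness for the vertex map.\<close>
  moreover have "inj_on f (\<Union>(skeleton (k - 1) (Ind X)))"
    using assms(1) by (rule inj_on_subset) (auto simp: skeleton_def Ind_def)
  ultimately show ?E
    unfolding simplicial_embedding_def Ind_map_def by blast
qed

section \<open>Regularity as a condition on \<open>k\<close>-element subsets\<close>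

text \<open>Injective \<open>k\<close>-tuples are the enumerations of \<open>k\<close>-element sets,
  and \<open>Q\<close> sees only the set of entries. For \<open>k = 0\<close> the condition
  \<open>finite \<sigma>\<close> excludes infinite sets, whose \<open>card\<close> is also
  0.\<close>

lemma all_injective_tuples_iff:
  "(\<forall>x :: nat \<Rightarrow> 'a. inj_on x {1..k} \<and> x ` {1..k} \<subseteq> X \<longrightarrow> Q (x ` {1..k})) \<longleftrightarrow>
   (\<forall>\<sigma>\<subseteq>X. card \<sigma> = k \<and> finite \<sigma> \<longrightarrow> Q \<sigma>)"
proof
  assume L: "\<forall>x :: nat \<Rightarrow> 'a. inj_on x {1..k} \<and> x ` {1..k} \<subseteq> X \<longrightarrow> Q (x ` {1..k})"
  show "\<forall>\<sigma>\<subseteq>X. card \<sigma> = k \<and> finite \<sigma> \<longrightarrow> Q \<sigma>"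
  proof (intro allI impI, elim conjE)
    fix \<sigma> assume "\<sigma> \<subseteq> X" "card \<sigma> = k" "finite \<sigma>"
    moreover from this obtain x where "bij_betw x {1..k} \<sigma>"
      using ex_bij_betw_nat_finite_1 by blast
    ultimately show "Q \<sigma>"
      using L by (metis bij_betw_def)
  qed
next
  assume "\<forall>\<sigma>\<subseteq>X. card \<sigma> = k \<and> finite \<sigma> \<longrightarrow> Q \<sigma>"
  then show "\<forall>x :: nat \<Rightarrow> 'a. inj_on x {1..k} \<and> x ` {1..k} \<subseteq> X \<longrightarrow> Q (x ` {1..k})"
    by (simp add: card_image)
qed

text \<open>Coefficients are transported along the bijection from \<open>J\<close> to its image.
  Injectivity matters: a repeated nonzero vector makes a family dependent but can leave its set of
  values independent.\<close>

lemma lin_independent_family_image: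
  assumes "inj_on x J"
  shows "lin_independent_family (x ` J) v \<longleftrightarrow> lin_independent_family J (\<lambda>j. v (x j))"
proof
  assume L: "lin_independent_family (x ` J) v"
  show "lin_independent_family J (\<lambda>j. v (x j))"
    unfolding lin_independent_family_def
  proof (intro allI impI)
    fix a assume "(\<Sum>j\<in>J. ds_scale (a j) (v (x j))) = 0"
    \<comment> \<open>Each coefficient is moved to the image point through the inverse of
      \<open>x\<close>.\<close>
    then have "(\<Sum>i\<in>x ` J. ds_scale (a (inv_into J x i)) (v i)) = 0"
      using assms by (simp add: sum.reindex)
    then have "\<forall>i\<in>x ` J. a (inv_into J x i) = 0"
      by (rule mp[OF spec[OF L[unfolded lin_independent_family_def], of "\<lambda>i. a (inv_into J x i)"]])
    then show "\<forall>j\<in>J. a j = 0"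
      using assms by simp
  qed
next
  assume R: "lin_independent_family J (\<lambda>j. v (x j))"
  show "lin_independent_family (x ` J) v"
    unfolding lin_independent_family_def
  proof (intro allI impI)
    fix a assume "(\<Sum>i\<in>x ` J. ds_scale (a i) (v i)) = 0"
    then have "(\<Sum>j\<in>J. ds_scale (a (x j)) (v (x j))) = 0"
      by (simp only: sum.reindex[OF assms] o_def)
    then have "\<forall>j\<in>J. a (x j) = 0"
      by (rule mp[OF spec[OF R[unfolded lin_independent_family_def], of "\<lambda>j. a (x j)"]])
    then show "\<forall>i\<in>x ` J. a i = 0"
      by blast
  qed
qed

text \<open>The same transport of coefficients also preserves their sum.\<close>

lemma aff_independent_family_image:
  assumes "inj_on x J"
  shows "aff_independent_family (x ` J) v \<longleftrightarrow> aff_independent_family J (\<lambda>j. v (x j))"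
proof
  assume L: "aff_independent_family (x ` J) v"
  show "aff_independent_family J (\<lambda>j. v (x j))"
    unfolding aff_independent_family_def
  proof (intro allI impI)
    fix a assume "(\<Sum>j\<in>J. ds_scale (a j) (v (x j))) = 0 \<and> sum a J = 0"
    then have "(\<Sum>i\<in>x ` J. ds_scale (a (inv_into J x i)) (v i)) = 0 \<and>
        (\<Sum>i\<in>x ` J. a (inv_into J x i)) = 0"
      using assms by (simp add: sum.reindex)
    then have "\<forall>i\<in>x ` J. a (inv_into J x i) = 0"
      by (rule mp[OF spec[OF L[unfolded aff_independent_family_def], of "\<lambda>i. a (inv_into J x i)"]])
    then show "\<forall>j\<in>J. a j = 0"
      using assms by simp
  qed
next
  assume R: "aff_independent_family J (\<lambda>j. v (x j))"
  show "aff_independent_family (x ` J) v"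
    unfolding aff_independent_family_def
  proof (intro allI impI)
    fix a assume "(\<Sum>i\<in>x ` J. ds_scale (a i) (v i)) = 0 \<and> sum a (x ` J) = 0"
    then have "(\<Sum>j\<in>J. ds_scale (a (x j)) (v (x j))) = 0 \<and> (\<Sum>j\<in>J. a (x j)) = 0"
      by (simp only: sum.reindex[OF assms] o_def)
    then have "\<forall>j\<in>J. a (x j) = 0"
      by (rule mp[OF spec[OF R[unfolded aff_independent_family_def], of "\<lambda>j. a (x j)"]])
    then show "\<forall>i\<in>x ` J. a i = 0"
      by blast
  qed
qed

text \<open>The transport along an injection is used twice, for the tuple \<open>x\<close> and for
  \<open>f\<close> on its entries; this turns independence of a family into independence of a set of
  vectors.\<close>

lemma k_regular_iff:
  assumes "inj_on f X"
  shows "k_regular k X f \<longleftrightarrow>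
    (\<forall>\<sigma>\<subseteq>X. card \<sigma> = k \<and> finite \<sigma> \<longrightarrow> lin_independent_family (f ` \<sigma>) (\<lambda>v. v))"
proof -
  have "k_regular k X f \<longleftrightarrow> (\<forall>x :: nat \<Rightarrow> _. inj_on x {1..k} \<and> x ` {1..k} \<subseteq> X \<longrightarrow>
      lin_independent_family (f ` x ` {1..k}) (\<lambda>v. v))"
    unfolding k_regular_def
    using assms by (auto simp: lin_independent_family_image inj_on_subset)
  then show ?thesis
    by (simp only: all_injective_tuples_iff
        [of k X "\<lambda>\<sigma>. lin_independent_family (f ` \<sigma>) (\<lambda>v. v)"])
qed

lemma affinely_k_regular_iff:
  assumes "inj_on f X"
  shows "affinely_k_regular k X f \<longleftrightarrow>
    (\<forall>\<sigma>\<subseteq>X. card \<sigma> = k \<and> finite \<sigma> \<longrightarrow> aff_independent_family (f ` \<sigma>) (\<lambda>v. v))"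
proof -
  have "affinely_k_regular k X f \<longleftrightarrow> (\<forall>x :: nat \<Rightarrow> _. inj_on x {1..k} \<and> x ` {1..k} \<subseteq> X \<longrightarrow>
      aff_independent_family (f ` x ` {1..k}) (\<lambda>v. v))"
    unfolding affinely_k_regular_def
    using assms by (auto simp: aff_independent_family_image inj_on_subset)
  then show ?thesis
    by (simp only: all_injective_tuples_iff
        [of k X "\<lambda>\<sigma>. aff_independent_family (f ` \<sigma>) (\<lambda>v. v)"])
qed

section \<open>The two equivalences\<close>

text \<open>This is the algebraic core, valid over every field, so the real and complex cases are
  both instances. The manifold enters only through the size of \<open>X\<close>, and the embedding
  only through injectivity and its range.\<close>

lemma regular_iff_simplicial_embedding:
  fixes f :: "'a \<Rightarrow> ('i \<Rightarrow>\<^sub>0 'f::field)"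
  assumes "inj_on f X" "f ` X \<subseteq> direct_sum I" "k > 0" "X = {} \<or> infinite X \<or> k \<le> card X"
  shows "affinely_k_regular k X f \<longleftrightarrow> simplicial_embedding (skeleton (k - 1) (Ind X))
      (skeleton (k - 1) (affine_frame_complex I)) (Ind_map f)" (is ?A)
    and "k_regular k X f \<longleftrightarrow> simplicial_embedding (skeleton (k - 1) (Ind X))
      (skeleton (k - 1) (linear_frame_complex I)) (Ind_map f)" (is ?B)
proof -
  have fin: "finite \<sigma>" if "card \<sigma> = k" for \<sigma> :: "'a set"
    using that assms(3) by (auto intro: card_ge_0_finite)
  have sub: "f ` \<sigma> \<subseteq> direct_sum I" if "\<sigma> \<subseteq> X" for \<sigma>
    using that assms(2) by blast
  \<comment> \<open>On \<open>k\<close>-element subsets of \<open>X\<close>, finiteness and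
    containment in the direct sum are automatic, so membership in the complex is just
    independence.\<close>
  have aff: "f ` \<sigma> \<in> affine_frame_complex I \<longleftrightarrow> aff_independent_family (f ` \<sigma>) (\<lambda>v. v)"
    if "\<sigma> \<subseteq> X" "card \<sigma> = k" for \<sigma>
    unfolding affine_frame_complex_def using fin[OF that(2)] sub[OF that(1)] by simp
  have lin: "f ` \<sigma> \<in> linear_frame_complex I \<longleftrightarrow> lin_independent_family (f ` \<sigma>) (\<lambda>v. v)"
    if "\<sigma> \<subseteq> X" "card \<sigma> = k" for \<sigma>
    unfolding linear_frame_complex_def using fin[OF that(2)] sub[OF that(1)]
    by (simp add: lin_independent_family_self)
  have "{} \<in> affine_frame_complex I" "{} \<in> linear_frame_complex I"
    by (simp_all add: affine_frame_complex_def linear_frame_complex_def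
        aff_independent_family_def ds.independent_empty)
  note emb = simplicial_embedding_skeleton_iff[OF assms(1,3,4) _ this(1)]
    simplicial_embedding_skeleton_iff[OF assms(1,3,4) _ this(2)]
  show ?A
    unfolding affinely_k_regular_iff[OF assms(1)]
      emb(1)[OF abstract_simplicial_complex_affine_frame_complex]
    using fin aff by blast
  show ?B
    unfolding k_regular_iff[OF assms(1)]
      emb(2)[OF abstract_simplicial_complex_linear_frame_complex]
    using fin lin by blast
qed

lemma embedding_map_inj_on:
  assumes "embedding_map X Y f"
  shows "inj_on f (topspace X)"
  using assms unfolding embedding_map_def by (rule homeomorphic_imp_injective_map)

lemma embedding_map_into_direct_sum:
  assumes "embedding_map X (direct_sum_topology I) f"
  shows "f ` topspace X \<subseteq> direct_sum I"
  using homeomorphic_imp_surjective_map[OF assms[unfolded embedding_map_def]]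
  unfolding topspace_subtopology topspace_direct_sum_topology by blast

theorem proposition8p4:
  fixes M :: "'a topology"
    and \<A> :: "('a set \<times> ('a \<Rightarrow> nat \<Rightarrow> real)) set"
    and n k :: nat
    and I :: "'i set"
  assumes "differentiable_manifold n M \<A>"
    and "n \<ge> 1 \<or> (\<exists>S. S \<subseteq> topspace M \<and> card S = k)"
    and "k \<ge> 2"
  shows "(\<forall>f :: 'a \<Rightarrow> ('i \<Rightarrow>\<^sub>0 real). embedding_map M (direct_sum_topology I) f \<longrightarrow>
            (affinely_k_regular k (topspace M) f \<longleftrightarrow>
               simplicial_embedding (skeleton (k - 1) (Ind (topspace M)))
                 (skeleton (k - 1) (affine_frame_complex I)) (Ind_map f)) \<and>
            (k_regular k (topspace M) f \<longleftrightarrow>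
               simplicial_embedding (skeleton (k - 1) (Ind (topspace M)))
                 (skeleton (k - 1) (linear_frame_complex I)) (Ind_map f))) \<and>
         (\<forall>f :: 'a \<Rightarrow> ('i \<Rightarrow>\<^sub>0 complex). embedding_map M (direct_sum_topology I) f \<longrightarrow>
            (affinely_k_regular k (topspace M) f \<longleftrightarrow>
               simplicial_embedding (skeleton (k - 1) (Ind (topspace M)))
                 (skeleton (k - 1) (affine_frame_complex I)) (Ind_map f)) \<and>
            (k_regular k (topspace M) f \<longleftrightarrow>
               simplicial_embedding (skeleton (k - 1) (Ind (topspace M)))
                 (skeleton (k - 1) (linear_frame_complex I)) (Ind_map f)))"
proof -
  \<comment> \<open>For \<open>n \<ge> 1\<close> the space is empty or infinite; otherwise the given
    \<open>S\<close> bounds the cardinality of a finite \<open>topspace M\<close> from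
    below.\<close>
  have "topspace M = {} \<or> infinite (topspace M) \<or> k \<le> card (topspace M)"
    using infinite_manifold[OF assms(1)] assms(2) card_mono by blast
  moreover have "k > 0"
    using assms(3) by simp
  ultimately show ?thesis
    by (intro conjI allI impI regular_iff_simplicial_embedding embedding_map_inj_on
        embedding_map_into_direct_sum)
qed

end
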